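(* Let $M=2$, $K=3$, and let $N=3$ or $N=5$. Let $A\in\mathbb{R}^{2\times N}$ be the matrix whose $i$-th column is $(\cos\theta_i,\sin\theta_i)^T$ with $$\theta_i=\frac{\pi(i-1)}{N},\qquad 1\le i\le N.$$ Then this set of angles minimizes the maximum condition number among all submatrices with $K=3$ columns. That is, for every matrix $B\in\mathbb{R}^{2\times N}$ all of whose columns have unit $\ell_2$ norm, $$\max_{S\subseteq\{1,\dots,N\},\,|S|=3}\kappa(A_S)\;\le\;\max_{S\subseteq\{1,\dots,N\},\,|S|=3}\kappa(B_S).$$
   Context: For a matrix $B\in\mathbb{R}^{2\times N}$ and a subset $S\subseteq\{1,\dots,N\}$ with $|S|=3$, $B_S\in\mathbb{R}^{2\times 3}$ denotes the submatrix consisting of the columns of $B$ indexed by $S$. The condition number of a $2\times 3$ matrix $C$ is $\kappa(C)=\sigma_{\max}(C)/\sigma_{\min}(C)$, where $\sigma_{\max}(C)\ge\sigma_{\min}(C)\ge 0$ are its two singular values (the square roots of the two eigenvalues of $CC^T$), with $\kappa(C)=+\infty$ if $\sigma_{\min}(C)=0$. *)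

theory Defs
  imports
    Complex_Main
    "HOL-Library.Extended_Real"
    "Jordan_Normal_Form.Char_Poly"
    "Jordan_Normal_Form.DL_Submatrix"
begin

definition l2_norm :: "real vec \<Rightarrow> real" where
  "l2_norm v = sqrt (v \<bullet> v)"

(* For C with two rows these are the two singular values: C * C^T is a real symmetric
   2 x 2 matrix, so its set of real eigenvalues is nonempty and has at most two elements;
   if it is a singleton, the eigenvalue is double and both singular values agree. *)
definition sigma_max :: "real mat \<Rightarrow> real" where
  "sigma_max C = sqrt (Max {k. eigenvalue (C * transpose_mat C) k})"

definition sigma_min :: "real mat \<Rightarrow> real" where
  "sigma_min C = sqrt (Min {k. eigenvalue (C * transpose_mat C) k})"

definition cond_number :: "real mat \<Rightarrow> ereal" where
  "cond_number C =
     (if sigma_min C = 0 then \<infinity> else ereal (sigma_max C / sigma_min C))"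

(* Matrix columns are indexed from 0, so the index sets S range over subsets of {0..<N}
   and column j here is the column with index j + 1 in the 1-based convention. *)
definition column_submatrix :: "real mat \<Rightarrow> nat set \<Rightarrow> real mat" where
  "column_submatrix B S = submatrix B UNIV S"

definition max_cond_number :: "nat \<Rightarrow> real mat \<Rightarrow> ereal" where
  "max_cond_number K B =
     Max {cond_number (column_submatrix B S) | S. S \<subseteq> {0..<dim_col B} \<and> card S = K}"

definition equiangular_mat :: "nat \<Rightarrow> real mat" where
  "equiangular_mat N =
     mat 2 N (\<lambda>(i, j). if i = 0 then cos (pi * real j / real N) else sin (pi * real j / real N))"

end

(* Read as a complex number and squared, a unit column doubles its angle; the Gram matrix of three
   unit columns then has the eigenvalues (3 + r) / 2 and (3 - r) / 2, where r is the modulus of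
   the sum of the three squares, so the condition number increases with r. For N = 3 the squares
   of the equiangular columns sum to 0. For N = 5 they are the fifth roots of unity, where a
   triple sum is minus the sum of the other two roots, so r is at most p = 2 cos (pi / 5).

   It remains to find, among any five points on the unit circle, three with r >= p. Take a closest
   pair. If no third point next to it gives r >= p, the other three points are confined to an
   arc on the opposite side which is so short that, although their gaps are no smaller than the
   minimal one, their own sum has modulus at least p. The relation p^2 = p + 1 reduces the last
   claim to a polynomial inequality. *)
theory Submission
  imports Defs
begin

section \<open>Triples of points on the unit circle\<close>

text \<open>For \<open>x = pi / 5\<close>, \<open>3 * x\<close> and \<open>2 * x\<close> are
  supplementary and have equal sines; dividing by \<open>sin x > 0\<close> leaves the equation of
  the golden ratio.\<close>

lemma golden_cos_square:
  fixes p :: real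
  defines "p \<equiv> 2 * cos (pi / 5)"
  shows "p\<^sup>2 = p + 1"
proof -
  define x :: real where "x = pi / 5"
  have s: "sin x > 0" unfolding x_def by (intro sin_gt_zero) auto
  have "sin (3 * x) = sin (pi - 2 * x)" by (rule arg_cong[of _ _ sin]) (simp add: x_def)
  then have "sin (3 * x) = 2 * sin x * cos x" by (simp only: sin_pi_minus sin_double)
  moreover have "sin (3 * x) = sin x * (4 * (cos x)\<^sup>2 - 1)"
  proof -
    have "sin (3 * x) = sin (2 * x) * cos x + cos (2 * x) * sin x"
      using sin_add[of "2 * x" x] by simp
    then show ?thesis
      unfolding sin_double cos_double_cos by (simp add: power2_eq_square algebra_simps)
  qed
  ultimately have "4 * (cos x)\<^sup>2 - 1 = 2 * cos x" using s by simp
  then show ?thesis by (simp add: p_def x_def power2_eq_square)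
qed

lemma golden_bounds:
  fixes p :: real
  assumes "p\<^sup>2 = p + 1" "p > 0"
  shows "8/5 < p" "p < 33/20"
proof -
  show "8/5 < p"
  proof (rule ccontr)
    assume neg: "\<not> ?thesis"
    with neg have "p * p \<le> 8/5 * p" using assms(2) by (intro mult_right_mono) auto
    then show False using assms neg unfolding power2_eq_square by linarith
  qed
  show "p < 33/20"
  proof (rule ccontr)
    assume neg: "\<not> ?thesis"
    with neg have "33/20 * p \<le> p * p" using assms(2) by (intro mult_right_mono) auto
    then show False using assms neg unfolding power2_eq_square by linarith
  qed
qed

text \<open>The two sides agree at \<open>y = 1\<close>, the case of the regular pentagon. For
  larger \<open>y\<close> the left side stays below this common value and the right side above
  it.\<close>

lemma golden_poly_ineq:
  fixes p y :: real
  assumes p: "p\<^sup>2 = p + 1" "p > 0" and y: "1 \<le> y" "y\<^sup>2 \<le> 2 * p"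
  shows "(2 * p - y\<^sup>2)\<^sup>2 * (y + p) \<le> y\<^sup>2 * (4 - p - y) * (4 * (y + p) - y\<^sup>2)"
proof -
  note pb = golden_bounds[OF p]
  define t where "t = y - 1"
  have t0: "0 \<le> t" and y_t: "y = 1 + t" using y by (auto simp: t_def)
  have "y < 37/20"
  proof (rule power_less_imp_less_base)
    show "y ^ 2 < (37/20) ^ 2" using y pb by (simp add: power2_eq_square)
  qed simp
  then have t1: "t \<le> 17/20" by (simp add: y_t)
  \<comment> \<open>\<open>E\<^sup>2 * F\<close> and \<open>h * G\<close> are the left and right
    sides at \<open>t = 0\<close>; \<open>E\<close> is the square root of 5.\<close>
  define E F G h where "E = 2 * p - 1" and "F = 1 + p" and "G = 4 * p + 3" and "h = 3 - p"
  have "E\<^sup>2 = 4 * p\<^sup>2 - 4 * p + 1" by (simp add: E_def power2_eq_square algebra_simps)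
  then have E2: "E\<^sup>2 = 5" using p by simp
  have "h * G = 9 * p + 9 - 4 * p\<^sup>2" by (simp add: G_def h_def power2_eq_square algebra_simps)
  then have EF: "E\<^sup>2 * F = h * G" using p by (simp add: E2 F_def)
  have tt: "t * t \<le> 17/20 * (17/20)" using t0 t1 by (intro mult_mono) auto
  have tt': "t * t \<le> 17/20 * t" using t0 t1 by (intro mult_right_mono) auto
  have "(2 * p - y\<^sup>2)\<^sup>2 \<le> (E - 2 * t)\<^sup>2"
    using y by (intro power_mono) (auto simp: E_def y_t power2_eq_square algebra_simps)
  then have "(2 * p - y\<^sup>2)\<^sup>2 * (y + p) \<le> (E - 2 * t)\<^sup>2 * (F + t)"
    using t0 pb by (intro mult_mono) (auto simp: y_t F_def)
  also have "\<dots> = E\<^sup>2 * F - t * (4 * E * F - E\<^sup>2 - 4 * (F - E) * t - 4 * (t * t))"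
    by (simp add: power2_eq_square algebra_simps)
  also have "\<dots> \<le> E\<^sup>2 * F"
  proof -
    have "11/5 * (13/5) \<le> E * F" using pb by (intro mult_mono) (auto simp: E_def F_def)
    moreover have "(F - E) * t \<le> 2/5 * 1" 
      using pb t0 t1 by (intro mult_mono) (auto simp: E_def F_def)
    ultimately have "0 \<le> 4 * E * F - E\<^sup>2 - 4 * (F - E) * t - 4 * (t * t)"
      using E2 tt by (simp only: mult.assoc)
    then show ?thesis using t0 by simp
  qed
  also have "\<dots> = h * G" by (rule EF)
  also have "\<dots> \<le> ((1 + t)\<^sup>2 * (h - t)) * (G + t * (2 - t))"
  proof (rule mult_mono)
    have "(2 - h) * t \<le> 7/10 * 1" using pb t0 t1 by (intro mult_mono) (auto simp: h_def)
    then have "0 \<le> t * (2 * h - 1 - (2 - h) * t - t * t)"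
      using pb t0 tt by (intro mult_nonneg_nonneg) (auto simp: h_def)
    also have "\<dots> = (1 + t)\<^sup>2 * (h - t) - h"
      by (simp add: power2_eq_square algebra_simps)
    finally show "h \<le> (1 + t)\<^sup>2 * (h - t)" by simp
  qed (use t0 t1 pb in \<open>auto simp: h_def G_def\<close>)
  also have "\<dots> = y\<^sup>2 * (4 - p - y) * (4 * (y + p) - y\<^sup>2)"
    by (simp add: y_t h_def G_def power2_eq_square algebra_simps)
  finally show ?thesis .
qed

text \<open>The addition formula gives \<open>cos (\<beta> - \<alpha>) = y / 4 + W\<close> with
  \<open>W\<close> the product of the sines. If the claim failed, squaring the resulting bound on
  \<open>W\<close> would eliminate the sines and contradict \<open>golden_poly_ineq\<close>.\<close>

lemma cos_diff_golden_bound: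
  fixes \<alpha> \<beta> p y :: real
  assumes p: "p\<^sup>2 = p + 1" "p > 0"
    and y: "4 * (cos \<alpha>)\<^sup>2 = y + p" "1 \<le> y" and b: "4 * cos \<alpha> * cos \<beta> = y"
    and s: "0 \<le> sin \<alpha>" "0 \<le> sin \<beta>"
  shows "p \<le> 2 * y * cos (\<beta> - \<alpha>)"
proof (rule ccontr)
  assume neg: "\<not> ?thesis"
  define W where "W = sin \<alpha> * sin \<beta>"
  have W0: "0 \<le> W" using s by (simp add: W_def)
  have "cos (\<beta> - \<alpha>) = y / 4 + W"
    using b by (simp add: cos_diff W_def algebra_simps)
  with neg have lt: "4 * y * W < 2 * p - y\<^sup>2" by (simp add: power2_eq_square algebra_simps)
  have yW: "0 \<le> 4 * y * W" using W0 y by simp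
  \<comment> \<open>The factor \<open>y + p\<close> is \<open>4 * (cos \<alpha>)\<^sup>2\<close>, so
    \<open>cos \<beta>\<close> enters only through the known product with
    \<open>cos \<alpha>\<close>.\<close>
  have "16 * (y + p) * W\<^sup>2 = (4 - 4 * (cos \<alpha>)\<^sup>2) * (4 * (4 * (cos \<alpha>)\<^sup>2) * (1 - (cos \<beta>)\<^sup>2))"
    using sin_squared_eq[of \<alpha>] sin_squared_eq[of \<beta>]
    by (simp add: W_def power_mult_distrib y(1)[symmetric]) (simp add: algebra_simps)
  also have "\<dots> = (4 - 4 * (cos \<alpha>)\<^sup>2) * (4 * (4 * (cos \<alpha>)\<^sup>2) - (4 * cos \<alpha> * cos \<beta>)\<^sup>2)"
    by (simp add: power2_eq_square algebra_simps)
  also have "\<dots> = (4 - p - y) * (4 * (y + p) - y\<^sup>2)"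
    by (simp only: b y(1)) simp
  finally have W2: "16 * (y + p) * W\<^sup>2 = (4 - p - y) * (4 * (y + p) - y\<^sup>2)" .
  have "y\<^sup>2 * (4 - p - y) * (4 * (y + p) - y\<^sup>2) = (4 * y * W)\<^sup>2 * (y + p)"
    using arg_cong[OF W2, of "\<lambda>x. y\<^sup>2 * x"] by (simp add: power2_eq_square algebra_simps)
  also have "\<dots> < (2 * p - y\<^sup>2)\<^sup>2 * (y + p)"
    using lt yW y p by (intro mult_strict_right_mono power_strict_mono) auto
  also have "\<dots> \<le> y\<^sup>2 * (4 - p - y) * (4 * (y + p) - y\<^sup>2)"
    by (intro golden_poly_ineq p y) (use lt yW in linarith)
  finally show False by simp
qed

section \<open>Five gaps around the circle\<close>

text \<open>Separates the half-sum of two gaps from their half-difference, the two quantities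
  estimated in \<open>gap_triple_bound\<close>.\<close>

lemma triple_cos_sum_factored:
  fixes a b :: real
  shows "3 + 2 * (cos a + cos b + cos (a + b)) =
    1 + 4 * cos ((a + b) / 2) * (cos ((a + b) / 2) + cos ((a - b) / 2))"
proof -
  have "cos (a + b) = 2 * (cos ((a + b) / 2))\<^sup>2 - 1"
    by (metis cos_double_cos field_sum_of_halves mult_2)
  then show ?thesis using cos_plus_cos[of a b]
    by (simp add: power2_eq_square algebra_simps)
qed

text \<open>\<open>Q x y\<close> is the squared modulus of the sum of three unit vectors with
  successive gaps \<open>x\<close> and \<open>y\<close>. The first two triples join the closest
  pair, at gap \<open>a\<close>, to one of its neighbours; the third consists of the other three
  points.\<close>

lemma gap_triple_bound:
  fixes a g2 g3 g4 g5 p :: real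
  assumes gaps: "0 \<le> a" "a \<le> g2" "a \<le> g3" "a \<le> g4" "a \<le> g5"
    and sum: "a + g2 + g3 + g4 + g5 = 2 * pi"
    and p_def: "p = 2 * cos (pi / 5)"
  defines "Q \<equiv> \<lambda>x y. 3 + 2 * (cos x + cos y + cos (x + y))"
  shows "p\<^sup>2 \<le> Q a g2 \<or> p\<^sup>2 \<le> Q g5 a \<or> p\<^sup>2 \<le> Q g3 g4"
proof (rule ccontr)
  assume "\<not> ?thesis"
  then have neg: "Q a g2 < p\<^sup>2" "Q g5 a < p\<^sup>2" "Q g3 g4 < p\<^sup>2" by auto
  have p2: "p\<^sup>2 = p + 1" using golden_cos_square by (simp add: p_def)
  have p0: "p > 0" unfolding p_def using cos_gt_zero[of "pi / 5"] by simp
  define \<alpha> where "\<alpha> = a / 2"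
  have al: "0 \<le> \<alpha>" "\<alpha> \<le> pi / 5" using gaps sum by (auto simp: \<alpha>_def)
  define c where "c = cos \<alpha>"
  have c: "p / 2 \<le> c" unfolding p_def c_def using al by (simp add: cos_monotone_0_pi_le)
  then have c0: "c > 0" using p0 by simp
  \<comment> \<open>Chosen so that \<open>Q a g < p\<^sup>2\<close> amounts to
    \<open>4 * c * cos (g + \<alpha>) < - y\<close>. Since \<open>p\<^sup>2 - p = 1\<close>, the
    bound \<open>p / 2 \<le> c\<close> becomes \<open>1 \<le> y\<close>.\<close>
  define y where "y = 4 * c\<^sup>2 - p"
  have "p\<^sup>2 \<le> (2 * c)\<^sup>2" using c p0 by (intro power_mono) auto
  then have y1: "1 \<le> y" using p2 by (simp add: y_def power_mult_distrib)
  have "c * c \<le> 1 * c" unfolding c_def using c0 c_def by (intro mult_right_mono) auto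
  then have y4c: "y \<le> 4 * c" using p0 by (simp add: y_def power2_eq_square)
  \<comment> \<open>A neighbour at distance \<open>\<beta>\<close> from the antipode of the pair's
    midpoint would give modulus exactly \<open>p\<close>.\<close>
  define \<beta> where "\<beta> = arccos (y / (4 * c))"
  have q: "0 \<le> y / (4 * c)" "y / (4 * c) \<le> 1" using y1 y4c c0 by simp_all
  have cb: "cos \<beta> = y / (4 * c)" unfolding \<beta>_def using q by (intro cos_arccos) auto
  have be: "0 \<le> \<beta>" "\<beta> \<le> pi / 2"
    unfolding \<beta>_def using q by (intro arccos_lbound arccos_le_pi2; simp)+
  have cy: "4 * c * cos \<beta> = y" using cb c0 by simp
  \<comment> \<open>\<open>g + \<alpha>\<close> is the angle between the neighbouring point and the midpoint of the closest pair.\<close>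
  have far: "pi - \<beta> < g + \<alpha>" if g: "0 \<le> g" "Q a g < p\<^sup>2" for g
  proof (rule ccontr)
    assume "\<not> ?thesis"
    then have "cos (pi - \<beta>) \<le> cos (g + \<alpha>)"
      using g al be by (intro cos_monotone_0_pi_le) auto
    then have "- cos \<beta> \<le> cos (g + \<alpha>)" by simp
    then have "4 * c * (- cos \<beta>) \<le> 4 * c * cos (g + \<alpha>)" using c0 by (intro mult_left_mono) auto
    then have ge: "- y \<le> 4 * c * cos (g + \<alpha>)" using cy by simp
    \<comment> \<open>The closest pair sums to a vector of length \<open>2 * c\<close> towards its
      midpoint.\<close>
    have "Q a g = 1 + (2 * c)\<^sup>2 + 4 * c * cos (g + \<alpha>)"
    proof -
      have ca: "cos a = 2 * c\<^sup>2 - 1" using cos_double_cos[of \<alpha>] by (simp add: \<alpha>_def c_def)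
      have "(a + g + g) / 2 = g + \<alpha>" "(a + g - g) / 2 = \<alpha>" by (simp_all add: \<alpha>_def field_simps)
      then have "cos (a + g) + cos g = 2 * cos (g + \<alpha>) * c"
        using cos_plus_cos[of "a + g" g] by (simp only: c_def)
      with ca show ?thesis by (simp add: Q_def power_mult_distrib algebra_simps)
    qed
    then show False using ge g p2 by (simp add: y_def power_mult_distrib)
  qed
  have Qc: "Q g5 a = Q a g5" by (simp add: Q_def add.commute)
  define x d where "x = (g3 + g4) / 2" and "d = \<bar>g3 - g4\<bar> / 2"
  \<comment> \<open>Both neighbours lie beyond \<open>pi - \<beta>\<close> from the midpoint, which
    leaves less than \<open>2 * \<beta>\<close> for \<open>g3 + g4\<close>.\<close>
  have xb: "x < \<beta>" using far[of g2] far[of g5] neg gaps sum Qc by (simp add: x_def \<alpha>_def)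
  \<comment> \<open>The smaller of \<open>g3\<close> and \<open>g4\<close> is \<open>x - d\<close>,
    and it is at least \<open>a = 2 * \<alpha>\<close>.\<close>
  have "\<bar>g3 - g4\<bar> \<le> g3 + g4 - 2 * a" using gaps by (simp add: abs_le_iff)
  then have d: "0 \<le> d" "d \<le> x - 2 * \<alpha>" by (simp_all add: x_def d_def \<alpha>_def field_simps)
  have cx: "cos \<beta> \<le> cos x" using xb d al be by (intro cos_monotone_0_pi_le) auto
  have cd: "cos (\<beta> - 2 * \<alpha>) \<le> cos d" using xb d al be by (intro cos_monotone_0_pi_le) auto
  have cd': "cos d = cos ((g3 - g4) / 2)"
    unfolding d_def by (metis abs_divide abs_numeral cos_abs_real)
  have cb0: "0 < cos \<beta>" using cb y1 c0 by simp
  \<comment> \<open>The bound is established for the extreme values \<open>x = \<beta>\<close>,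
    \<open>d = \<beta> - 2 * \<alpha>\<close> and carried over to the actual ones by monotonicity of
    cosine.\<close>
  have "p \<le> 2 * y * cos (\<beta> - \<alpha>)"
    using p2 p0 y1 cy al be
    by (intro cos_diff_golden_bound) (auto simp: y_def c_def intro!: sin_ge_zero)
  also have "\<dots> = 4 * cos \<beta> * (2 * c * cos (\<beta> - \<alpha>))" by (simp flip: cy)
  also have "2 * c * cos (\<beta> - \<alpha>) = cos \<beta> + cos (\<beta> - 2 * \<alpha>)"
    using cos_add[of "\<beta> - \<alpha>" \<alpha>] cos_diff[of "\<beta> - \<alpha>" \<alpha>] by (simp add: c_def algebra_simps)
  also have "4 * cos \<beta> * (cos \<beta> + cos (\<beta> - 2 * \<alpha>)) \<le> 4 * cos x * (cos x + cos d)"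
  proof (rule mult_mono)
    show "0 \<le> cos \<beta> + cos (\<beta> - 2 * \<alpha>)"
      by (smt (verit) cb0 be al d xb cos_ge_zero pi_gt_zero)
  qed (use cx cd cb0 in auto)
  also have "1 + \<dots> = Q g3 g4"
    unfolding Q_def triple_cos_sum_factored x_def cd' ..
  finally show False using neg p2 by simp
qed

section \<open>From gaps to unit complex numbers\<close>

text \<open>Identifies the expression \<open>Q\<close> of \<open>gap_triple_bound\<close>: the third
  difference is the sum of the first two.\<close>

lemma norm_cis_triple:
  "(norm (cis x + cis y + cis z))\<^sup>2 = 3 + 2 * (cos (y - x) + cos (z - y) + cos (z - x))"
proof -
  have "(norm (cis x + cis y + cis z))\<^sup>2 =
      ((sin x)\<^sup>2 + (cos x)\<^sup>2) + ((sin y)\<^sup>2 + (cos y)\<^sup>2) + ((sin z)\<^sup>2 + (cos z)\<^sup>2)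
      + 2 * (cos (y - x) + cos (z - y) + cos (z - x))"
    unfolding cmod_power2 cos_diff
    by (simp add: power2_eq_square algebra_simps
        del: sin_cos_squared_add sin_cos_squared_add2 sin_cos_squared_add3)
  then show ?thesis by simp
qed

lemma cis_add_2pi: "cis (x + 2 * pi) = cis x"
  by (simp add: complex_eq_iff)

lemma five_points_triple_bound:
  assumes ord: "t1 \<le> t2"
    and min: "t2 - t1 \<le> t3 - t2" "t2 - t1 \<le> t4 - t3" "t2 - t1 \<le> t5 - t4" "t2 - t1 \<le> t1 + 2 * pi - t5"
  shows "2 * cos (pi / 5) \<le> norm (cis t1 + cis t2 + cis t3) \<or>
    2 * cos (pi / 5) \<le> norm (cis t5 + cis t1 + cis t2) \<or>
    2 * cos (pi / 5) \<le> norm (cis t3 + cis t4 + cis t5)"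
proof -
  define p where "p = 2 * cos (pi / 5)"
  \<comment> \<open>Turning \<open>t5\<close> back by a full circle makes it precede
    \<open>t1\<close>, at the gap \<open>t1 + 2 * pi - t5\<close>.\<close>
  have e: "norm (cis t5 + cis t1 + cis t2) = norm (cis (t5 - 2 * pi) + cis t1 + cis t2)"
    using cis_add_2pi[of "t5 - 2 * pi"] by simp
  have "p\<^sup>2 \<le> (norm (cis t1 + cis t2 + cis t3))\<^sup>2 \<or> p\<^sup>2 \<le> (norm (cis t5 + cis t1 + cis t2))\<^sup>2 \<or>
    p\<^sup>2 \<le> (norm (cis t3 + cis t4 + cis t5))\<^sup>2"
    unfolding e norm_cis_triple
    using gap_triple_bound[of "t2 - t1" "t3 - t2" "t4 - t3" "t5 - t4" "t1 + 2 * pi - t5" p]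
      ord min by (simp add: p_def algebra_simps)
  then show ?thesis unfolding p_def[symmetric] by (meson norm_ge_zero power2_le_imp_le)
qed

text \<open>The points are sorted by argument and relabelled cyclically so that the smallest of the
  five gaps comes first.\<close>

lemma five_units_triple_bound:
  fixes u :: "nat \<Rightarrow> complex"
  assumes unit: "\<And>j. j < 5 \<Longrightarrow> norm (u j) = 1"
  shows "\<exists>S \<subseteq> {0..<5}. card S = 3 \<and> 2 * cos (pi / 5) \<le> norm (\<Sum>j\<in>S. u j)"
proof -
  \<comment> \<open>Sorting indices instead of points keeps coincident points apart, so three
    positions always yield a set of size 3.\<close>
  define xs where "xs = sort_key (\<lambda>j. Arg (u j)) [0..<5]"
  define v where "v k = Arg (u (xs ! k))" for k
  have xs: "length xs = 5" "set xs = {0..<5}" "distinct xs" by (simp_all add: xs_def)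
  have lt: "xs ! k < 5" if "k < 5" for k using nth_mem[of k xs] that xs by auto
  have u: "u (xs ! k) = cis (v k)" if "k < 5" for k
  proof -
    have "norm (u (xs ! k)) = 1" using unit lt that by blast
    moreover from this have "u (xs ! k) \<noteq> 0" by auto
    ultimately show ?thesis by (simp add: v_def cis_Arg sgn_div_norm)
  qed
  have "sorted (map (\<lambda>j. Arg (u j)) xs)" by (simp add: xs_def)
  then have mono: "v i \<le> v j" if "i \<le> j" "j < 5" for i j
    using sorted_nth_mono[of "map (\<lambda>j. Arg (u j)) xs" i j] that xs(1) by (simp add: v_def)
  have ord: "v 0 \<le> v 1" "v 1 \<le> v 2" "v 2 \<le> v 3" "v 3 \<le> v 4" by (intro mono; simp)+
  have wrap: "v 4 \<le> v 0 + 2 * pi"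
    using Arg_bounded[of "u (xs ! 4)"] Arg_bounded[of "u (xs ! 0)"] by (simp add: v_def)
  have pick: ?thesis
    if "2 * cos (pi / 5) \<le> norm (cis (v a) + cis (v b) + cis (v c))"
      and "a < 5" "b < 5" "c < 5" "a \<noteq> b" "b \<noteq> c" "a \<noteq> c" for a b c
  proof -
    have ne: "xs ! a \<noteq> xs ! b" "xs ! b \<noteq> xs ! c" "xs ! a \<noteq> xs ! c"
      using that xs by (simp_all add: nth_eq_iff_index_eq)
    then have "(\<Sum>j\<in>{xs ! a, xs ! b, xs ! c}. u j) = cis (v a) + cis (v b) + cis (v c)"
      using that by (simp add: u add.assoc)
    moreover have "card {xs ! a, xs ! b, xs ! c} = 3" using ne by simp
    ultimately show ?thesis using that lt
      by (intro exI[of _ "{xs ! a, xs ! b, xs ! c}"]) auto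
  qed
  define m where "m = Min {v 1 - v 0, v 2 - v 1, v 3 - v 2, v 4 - v 3, v 0 + 2 * pi - v 4}"
  have m_le: "m \<le> v 1 - v 0" "m \<le> v 2 - v 1" "m \<le> v 3 - v 2" "m \<le> v 4 - v 3"
    "m \<le> v 0 + 2 * pi - v 4"
    unfolding m_def by (intro Min_le; simp)+
  have "m \<in> {v 1 - v 0, v 2 - v 1, v 3 - v 2, v 4 - v 3, v 0 + 2 * pi - v 4}"
    unfolding m_def by (intro Min_in) auto
  then consider "m = v 1 - v 0" | "m = v 2 - v 1" | "m = v 3 - v 2" | "m = v 4 - v 3"
    | "m = v 0 + 2 * pi - v 4" by blast
  then show ?thesis
  proof cases
    case 1
    have "2 * cos (pi / 5) \<le> norm (cis (v 0) + cis (v 1) + cis (v 2)) \<or>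
      2 * cos (pi / 5) \<le> norm (cis (v 4) + cis (v 0) + cis (v 1)) \<or>
      2 * cos (pi / 5) \<le> norm (cis (v 2) + cis (v 3) + cis (v 4))"
      by (rule five_points_triple_bound) (use ord wrap m_le 1 in linarith)+
    then show ?thesis by (elim disjE) (erule pick; simp)+
  next
    case 2
    \<comment> \<open>In this and the following cases, points past the end of the list receive
      \<open>2 * pi\<close>, which keeps the angles increasing and leaves \<open>cis\<close>
      unchanged.\<close>
    have "2 * cos (pi / 5) \<le> norm (cis (v 1) + cis (v 2) + cis (v 3)) \<or>
      2 * cos (pi / 5) \<le> norm (cis (v 0 + 2 * pi) + cis (v 1) + cis (v 2)) \<or>
      2 * cos (pi / 5) \<le> norm (cis (v 3) + cis (v 4) + cis (v 0 + 2 * pi))"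
      by (rule five_points_triple_bound) (use ord wrap m_le 2 in linarith)+
    then show ?thesis unfolding cis_add_2pi by (elim disjE) (erule pick; simp)+
  next
    case 3
    have "2 * cos (pi / 5) \<le> norm (cis (v 2) + cis (v 3) + cis (v 4)) \<or>
      2 * cos (pi / 5) \<le> norm (cis (v 1 + 2 * pi) + cis (v 2) + cis (v 3)) \<or>
      2 * cos (pi / 5) \<le> norm (cis (v 4) + cis (v 0 + 2 * pi) + cis (v 1 + 2 * pi))"
      by (rule five_points_triple_bound) (use ord wrap m_le 3 in linarith)+
    then show ?thesis unfolding cis_add_2pi by (elim disjE) (erule pick; simp)+
  next
    case 4
    have "2 * cos (pi / 5) \<le> norm (cis (v 3) + cis (v 4) + cis (v 0 + 2 * pi)) \<or>
      2 * cos (pi / 5) \<le> norm (cis (v 2 + 2 * pi) + cis (v 3) + cis (v 4)) \<or>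
      2 * cos (pi / 5) \<le> norm (cis (v 0 + 2 * pi) + cis (v 1 + 2 * pi) + cis (v 2 + 2 * pi))"
      by (rule five_points_triple_bound) (use ord wrap m_le 4 in linarith)+
    then show ?thesis unfolding cis_add_2pi by (elim disjE) (erule pick; simp)+
  next
    case 5
    have "2 * cos (pi / 5) \<le> norm (cis (v 4) + cis (v 0 + 2 * pi) + cis (v 1 + 2 * pi)) \<or>
      2 * cos (pi / 5) \<le> norm (cis (v 3 + 2 * pi) + cis (v 4) + cis (v 0 + 2 * pi)) \<or>
      2 * cos (pi / 5) \<le> norm (cis (v 1 + 2 * pi) + cis (v 2 + 2 * pi) + cis (v 3 + 2 * pi))"
      by (rule five_points_triple_bound) (use ord wrap m_le 5 in linarith)+
    then show ?thesis unfolding cis_add_2pi by (elim disjE) (erule pick; simp)+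
  qed
qed

section \<open>Condition numbers of three unit columns\<close>

text \<open>Converts sums over column positions of a submatrix into sums over its index set.\<close>

lemma bij_betw_pick:
  assumes "finite S"
  shows "bij_betw (pick S) {..<card S} S"
proof -
  have inj: "inj_on (pick S) {..<card S}"
  proof (rule linorder_inj_onI')
    fix i j assume "j \<in> {..<card S}" "i < j"
    then show "pick S i \<noteq> pick S j" using pick_mono_le[of j S i] by simp
  qed
  have "pick S ` {..<card S} \<subseteq> S"
    unfolding image_subset_iff lessThan_iff by (intro allI ballI) (simp add: pick_in_set_le)
  then have "pick S ` {..<card S} = S"
    by (rule card_subset_eq[OF assms]) (simp only: card_image[OF inj] card_lessThan)
  with inj show ?thesis by (simp add: bij_betw_def)
qed

lemma column_submatrix_carrier:
  assumes "B \<in> carrier_mat n N" "S \<subseteq> {0..<N}"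
  shows "column_submatrix B S \<in> carrier_mat n (card S)"
proof -
  have "{j. j < dim_col B \<and> j \<in> S} = S" using assms by auto
  then show ?thesis using assms
    by (intro carrier_matI) (simp_all add: column_submatrix_def dim_submatrix)
qed

lemma column_submatrix_gram:
  assumes B: "B \<in> carrier_mat n N" and S: "S \<subseteq> {0..<N}" and ik: "i < n" "k < n"
  shows "(column_submatrix B S * (column_submatrix B S)\<^sup>T) $$ (i, k) = (\<Sum>j\<in>S. B $$ (i, j) * B $$ (k, j))"
proof -
  define C where "C = column_submatrix B S"
  have C: "C \<in> carrier_mat n (card S)" unfolding C_def by (rule column_submatrix_carrier[OF B S])
  have S': "{j. j < dim_col B \<and> j \<in> S} = S" using B S by auto
  have ent: "C $$ (l, m) = B $$ (l, pick S m)" if "l < n" "m < card S" for l m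
    using that B S' by (simp add: C_def column_submatrix_def submatrix_index pick_UNIV)
  have "(C * C\<^sup>T) $$ (i, k) = (\<Sum>m<card S. C $$ (i, m) * C $$ (k, m))"
    using C ik by (simp add: scalar_prod_def lessThan_atLeast0)
  also have "\<dots> = (\<Sum>m<card S. B $$ (i, pick S m) * B $$ (k, pick S m))"
    using ik by (simp add: ent)
  also have "\<dots> = (\<Sum>j\<in>S. B $$ (i, j) * B $$ (k, j))"
    using S by (intro sum.reindex_bij_betw bij_betw_pick) (auto intro: finite_subset)
  finally show ?thesis by (simp only: C_def)
qed

lemma det_two_by_two:
  fixes A :: "'a :: comm_ring_1 mat"
  assumes A: "A \<in> carrier_mat 2 2"
  shows "det A = A $$ (0, 0) * A $$ (1, 1) - A $$ (0, 1) * A $$ (1, 0)"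
proof -
  have minor: "det (mat_delete A i j) = mat_delete A i j $$ (0, 0)" for i j
    using mat_delete_carrier[OF A, of i j] by (intro det_single) simp
  have "det A = A $$ (0, 0) * cofactor A 0 0 + A $$ (1, 0) * cofactor A 1 0"
    using laplace_expansion_column[OF A, of 0] by (simp add: numeral_2_eq_2 lessThan_Suc)
  moreover have "mat_delete A 0 0 $$ (0, 0) = A $$ (1, 1)" "mat_delete A 1 0 $$ (0, 0) = A $$ (0, 1)"
    using A by (simp_all add: mat_delete_def)
  ultimately show ?thesis by (simp add: cofactor_def minor mult.commute)
qed

text \<open>\<open>\<rho>\<^sup>2\<close> is the discriminant of the characteristic polynomial. If
  it vanishes, the two listed roots coincide.\<close>

lemma eigenvalues_sym_two_by_two:
  fixes G :: "real mat"
  assumes G: "G \<in> carrier_mat 2 2" and sym: "G $$ (1, 0) = G $$ (0, 1)"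
    and tr: "G $$ (0, 0) + G $$ (1, 1) = t"
  defines "\<rho> \<equiv> sqrt ((G $$ (0, 0) - G $$ (1, 1))\<^sup>2 + (2 * G $$ (0, 1))\<^sup>2)"
  shows "{k. eigenvalue G k} = {(t - \<rho>) / 2, (t + \<rho>) / 2}"
proof -
  have r2: "\<rho>\<^sup>2 = (G $$ (0, 0) - G $$ (1, 1))\<^sup>2 + (2 * G $$ (0, 1))\<^sup>2" by (simp add: \<rho>_def)
  have roots: "eigenvalue G k \<longleftrightarrow> k = (t - \<rho>) / 2 \<or> k = (t + \<rho>) / 2" for k
  proof -
    have "eigenvalue G k \<longleftrightarrow> det (char_matrix G k) = 0" by (rule eigenvalue_det[OF G])
    also have "det (char_matrix G k) = (G $$ (0, 0) - k) * (G $$ (1, 1) - k) - (G $$ (0, 1))\<^sup>2"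
      using G sym by (subst det_two_by_two) (simp_all add: char_matrix_def power2_eq_square)
    also have "\<dots> = ((2 * k - t)\<^sup>2 - \<rho>\<^sup>2) / 4"
      unfolding r2 tr[symmetric] by (simp add: power2_eq_square algebra_simps)
    also have "(2 * k - t)\<^sup>2 - \<rho>\<^sup>2 = (2 * k - t - \<rho>) * (2 * k - t + \<rho>)"
      by (simp add: power2_eq_square algebra_simps)
    also have "\<dots> / 4 = 0 \<longleftrightarrow> 2 * k - t - \<rho> = 0 \<or> 2 * k - t + \<rho> = 0" by simp
    also have "\<dots> \<longleftrightarrow> k = (t - \<rho>) / 2 \<or> k = (t + \<rho>) / 2" by argo
    finally show ?thesis .
  qed
  show ?thesis unfolding roots by blast
qed

section \<open>The condition number as a function of the resultant\<close>

text \<open>For a column \<open>(x, y)\<close> the parts of the square are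
  \<open>x\<^sup>2 - y\<^sup>2\<close> and \<open>2 * x * y\<close>. Summed over a triple they
  become the two terms squared in the \<open>\<rho>\<close> of
  \<open>eigenvalues_sym_two_by_two\<close>.\<close>

definition col_square :: "real mat \<Rightarrow> nat \<Rightarrow> complex" where
  "col_square B j = (Complex (B $$ (0, j)) (B $$ (1, j)))\<^sup>2"

text \<open>The value 3 is attained when the three squares coincide, that is, for parallel columns,
  where the smaller singular value is 0.\<close>

definition cond_of_resultant :: "real \<Rightarrow> ereal" where
  "cond_of_resultant r = (if r = 3 then \<infinity> else ereal (sqrt ((3 + r) / 2) / sqrt ((3 - r) / 2)))"

lemma l2_norm_col:
  assumes "B \<in> carrier_mat 2 N" "j < N"
  shows "l2_norm (col B j) = sqrt ((B $$ (0, j))\<^sup>2 + (B $$ (1, j))\<^sup>2)"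
  using assms by (simp add: l2_norm_def scalar_prod_def numeral_2_eq_2 power2_eq_square)

lemma norm_col_square:
  assumes "B \<in> carrier_mat 2 N" "j < N" "l2_norm (col B j) = 1"
  shows "norm (col_square B j) = 1"
proof -
  have "norm (Complex (B $$ (0, j)) (B $$ (1, j))) = 1"
    using assms(3) l2_norm_col[OF assms(1,2)] by (simp add: cmod_def)
  then show ?thesis by (simp add: col_square_def norm_power)
qed

text \<open>Unit columns fix the trace of the Gram matrix at 3, so only the gap between its
  eigenvalues varies, and that gap is the modulus of the sum of the squares.\<close>

lemma cond_number_column_submatrix:
  assumes B: "B \<in> carrier_mat 2 N" and unit: "\<forall>j<N. l2_norm (col B j) = 1"
    and S: "S \<subseteq> {0..<N}" "card S = 3"
  shows "cond_number (column_submatrix B S) = cond_of_resultant (norm (\<Sum>j\<in>S. col_square B j))"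
proof -
  define C where "C = column_submatrix B S"
  define G where "G = C * C\<^sup>T"
  define r where "r = norm (\<Sum>j\<in>S. col_square B j)"
  have C: "C \<in> carrier_mat 2 3" using column_submatrix_carrier[OF B S(1)] S(2) by (simp add: C_def)
  have G: "G \<in> carrier_mat 2 2" using C by (simp add: G_def)
  have ent: "G $$ (i, k) = (\<Sum>j\<in>S. B $$ (i, j) * B $$ (k, j))" if "i < 2" "k < 2" for i k
    unfolding G_def C_def using column_submatrix_gram[OF B S(1) that] .
  have one: "(B $$ (0, j))\<^sup>2 + (B $$ (1, j))\<^sup>2 = 1" if "j \<in> S" for j
    using unit l2_norm_col[OF B, of j] S(1) that by auto
  have "G $$ (0, 0) + G $$ (1, 1) = (\<Sum>j\<in>S. (B $$ (0, j))\<^sup>2 + (B $$ (1, j))\<^sup>2)"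
    by (simp add: ent sum.distrib power2_eq_square)
  also have "\<dots> = (\<Sum>j\<in>S. 1)" by (intro sum.cong refl one)
  also have "\<dots> = 3" using S(2) by simp
  finally have tr: "G $$ (0, 0) + G $$ (1, 1) = 3" .
  have sym: "G $$ (1, 0) = G $$ (0, 1)" by (simp add: ent mult.commute)
  have "r = sqrt ((G $$ (0, 0) - G $$ (1, 1))\<^sup>2 + (2 * G $$ (0, 1))\<^sup>2)"
    by (simp add: r_def cmod_def col_square_def ent power2_eq_square sum_subtractf sum_distrib_left
        mult.assoc)
  then have "{k. eigenvalue G k} = {(3 - r) / 2, (3 + r) / 2}"
    using eigenvalues_sym_two_by_two[OF G sym tr] by simp
  moreover have "0 \<le> r" by (simp add: r_def)
  ultimately have "sigma_max C = sqrt ((3 + r) / 2)" "sigma_min C = sqrt ((3 - r) / 2)"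
    by (simp_all add: sigma_max_def sigma_min_def G_def[symmetric] max_def min_def)
  then show ?thesis unfolding C_def[symmetric] r_def[symmetric]
    by (auto simp: cond_number_def cond_of_resultant_def)
qed

lemma cond_of_resultant_mono:
  assumes "0 \<le> r" "r \<le> s" "s \<le> 3"
  shows "cond_of_resultant r \<le> cond_of_resultant s"
proof (cases "s = 3")
  case False
  then have "sqrt ((3 + r) / 2) / sqrt ((3 - r) / 2) \<le> sqrt ((3 + s) / 2) / sqrt ((3 - s) / 2)"
    using assms by (intro frac_le real_sqrt_le_mono) auto
  then show ?thesis using assms False by (simp add: cond_of_resultant_def)
qed (simp add: cond_of_resultant_def)

text \<open>A threshold \<open>r\<close> separates the matrices: some triple \<open>T\<close> of
  \<open>B\<close> has a resultant at least as large as every triple of \<open>A\<close>, and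
  monotonicity passes this on to the maxima.\<close>

lemma max_cond_number_le:
  assumes A: "A \<in> carrier_mat 2 N" "\<forall>j<N. l2_norm (col A j) = 1"
    and B: "B \<in> carrier_mat 2 N" "\<forall>j<N. l2_norm (col B j) = 1"
    and upper: "\<And>S. S \<subseteq> {0..<N} \<Longrightarrow> card S = 3 \<Longrightarrow> norm (\<Sum>j\<in>S. col_square A j) \<le> r"
    and lower: "\<exists>S \<subseteq> {0..<N}. card S = 3 \<and> r \<le> norm (\<Sum>j\<in>S. col_square B j)"
  shows "max_cond_number 3 A \<le> max_cond_number 3 B"
proof -
  obtain T where T: "T \<subseteq> {0..<N}" "card T = 3" "r \<le> norm (\<Sum>j\<in>T. col_square B j)"
    using lower by blast
  have "norm (\<Sum>j\<in>T. col_square B j) \<le> (\<Sum>j\<in>T. 1)"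
    using T(1) B by (intro sum_norm_le) (auto simp: norm_col_square)
  \<comment> \<open>The triangle inequality keeps the resultant in the range where
    \<open>cond_of_resultant\<close> is monotone.\<close>
  then have T3: "norm (\<Sum>j\<in>T. col_square B j) \<le> 3" using T(2) by simp
  have fin: "finite {cond_number (column_submatrix M S) | S. S \<subseteq> {0..<dim_col M} \<and> card S = 3}" for M
    by simp
  show ?thesis unfolding max_cond_number_def
  proof (rule Max.boundedI[OF fin])
    show "{cond_number (column_submatrix A S) | S. S \<subseteq> {0..<dim_col A} \<and> card S = 3} \<noteq> {}"
      using T A by auto
    fix x assume "x \<in> {cond_number (column_submatrix A S) | S. S \<subseteq> {0..<dim_col A} \<and> card S = 3}"
    then obtain S where S: "S \<subseteq> {0..<N}" "card S = 3" and x: "x = cond_number (column_submatrix A S)"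
      using A by auto
    have "x = cond_of_resultant (norm (\<Sum>j\<in>S. col_square A j))"
      unfolding x by (rule cond_number_column_submatrix[OF A S])
    also have "\<dots> \<le> cond_of_resultant (norm (\<Sum>j\<in>T. col_square B j))"
      using upper[OF S] T(3) T3 by (intro cond_of_resultant_mono) auto
    also have "\<dots> = cond_number (column_submatrix B T)"
      by (rule cond_number_column_submatrix[OF B T(1,2), symmetric])
    also have "\<dots> \<le> Max {cond_number (column_submatrix B S) | S. S \<subseteq> {0..<dim_col B} \<and> card S = 3}"
      using T B by (intro Max_ge[OF fin]) auto
    finally show "x \<le> \<dots>" .
  qed
qed

section \<open>The equiangular matrices\<close>

lemma equiangular_mat_carrier: "equiangular_mat N \<in> carrier_mat 2 N"
  by (simp add: equiangular_mat_def)

lemma l2_norm_col_equiangular_mat: "j < N \<Longrightarrow> l2_norm (col (equiangular_mat N) j) = 1"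
  by (simp add: l2_norm_col[OF equiangular_mat_carrier]) (simp add: equiangular_mat_def)

lemma col_square_equiangular_mat:
  assumes "j < N"
  shows "col_square (equiangular_mat N) j = cis (2 * pi * real j / real N)"
proof -
  have "Complex (equiangular_mat N $$ (0, j)) (equiangular_mat N $$ (1, j)) = cis (pi * real j / real N)"
    using assms by (simp add: equiangular_mat_def complex_eq_iff)
  then show ?thesis by (simp add: col_square_def DeMoivre mult.assoc)
qed

lemma sum_cis_roots_unity:
  assumes "1 < N"
  shows "(\<Sum>j<N. cis (2 * pi * real j / real N)) = 0"
  using sum.reindex_bij_betw[OF Complex.bij_betw_roots_unity, of N "\<lambda>z. z"] sum_roots_unity[OF assms] assms
  by simp

lemma norm_cis_add: "norm (cis a + cis b) = 2 * \<bar>cos ((a - b) / 2)\<bar>"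
proof -
  have "cis a + cis b = cis ((a + b) / 2) * complex_of_real (2 * cos ((a - b) / 2))"
    by (simp add: complex_eq_iff cos_plus_cos sin_plus_sin)
  then show ?thesis by (simp add: norm_mult)
qed

text \<open>All five roots of unity sum to 0, so a triple has the same modulus as the sum of the two
  remaining roots.\<close>

lemma equiangular_resultant_le:
  assumes S: "S \<subseteq> {0..<5}" "card S = 3"
  shows "norm (\<Sum>j\<in>S. col_square (equiangular_mat 5) j) \<le> 2 * cos (pi / 5)"
proof -
  let ?z = "\<lambda>j::nat. cis (2 * pi * real j / 5)"
  have "card ({0..<5} - S) = 2" using S by (simp add: card_Diff_subset finite_subset)
  then obtain a b where ab: "{0..<5} - S = {a, b}" "a \<noteq> b" by (meson card_2_iff)
  then have lt: "a < 5" "b < 5" by auto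
  have "(\<Sum>j\<in>S. ?z j) + (\<Sum>j\<in>{0..<5} - S. ?z j) = 0"
    using sum_cis_roots_unity[of 5] sum.subset_diff[OF S(1), of ?z]
    by (simp add: lessThan_atLeast0 add.commute)
  then have "(\<Sum>j\<in>S. ?z j) + (?z a + ?z b) = 0" using ab by simp
  then have "norm (\<Sum>j\<in>S. ?z j) = norm (?z a + ?z b)"
    unfolding add_eq_0_iff2 by (simp only: norm_minus_cancel)
  also have "\<dots> = 2 * \<bar>cos (pi * (real a - real b) / 5)\<bar>"
    unfolding norm_cis_add by (simp add: diff_divide_distrib right_diff_distrib)
  also have "(\<Sum>j\<in>S. ?z j) = (\<Sum>j\<in>S. col_square (equiangular_mat 5) j)"
    using S by (intro sum.cong) (auto simp: col_square_equiangular_mat)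
  finally have eq: "norm (\<Sum>j\<in>S. col_square (equiangular_mat 5) j) = 2 * \<bar>cos (pi * (real a - real b) / 5)\<bar>" .
  \<comment> \<open>Distinct indices below 5 differ by 1 to 4, so the angle lies between
    \<open>pi / 5\<close> and \<open>pi - pi / 5\<close>, where the cosine is at most
    \<open>cos (pi / 5)\<close> in absolute value.\<close>
  define k where "k = \<bar>real a - real b\<bar>"
  have k: "1 \<le> k" "k \<le> 4" using lt ab(2) by (auto simp: k_def)
  have "cos (pi * (real a - real b) / 5) = cos (pi * k / 5)"
    by (metis abs_divide abs_mult abs_numeral abs_of_pos cos_abs_real k_def pi_gt_zero)
  moreover have "cos (pi * k / 5) \<le> cos (pi / 5)"
    using k by (intro cos_monotone_0_pi_le) auto
  moreover have "cos (pi - pi / 5) \<le> cos (pi * k / 5)"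
    using k by (intro cos_monotone_0_pi_le) (auto simp: field_simps)
  then have "- cos (pi / 5) \<le> cos (pi * k / 5)" by (simp only: cos_pi_minus)
  ultimately show ?thesis unfolding eq by (simp add: abs_le_iff)
qed

theorem theorem4p2:
  fixes N :: nat and B :: "real mat"
  assumes "N = 3 \<or> N = 5"
    and "B \<in> carrier_mat 2 N"
    and "\<forall>j < N. l2_norm (col B j) = 1"
  shows "max_cond_number 3 (equiangular_mat N) \<le> max_cond_number 3 B"
  using assms(1)
proof
  assume N: "N = 3"
  \<comment> \<open>The only triple is the full index set, whose squares sum to 0; the threshold 0
    is then trivially reached by \<open>B\<close>.\<close>
  have upper: "norm (\<Sum>j\<in>S. col_square (equiangular_mat N) j) \<le> 0"
    if S: "S \<subseteq> {0..<N}" "card S = 3" for S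
  proof -
    have "S = {..<N}" using S N by (simp add: card_subset_eq lessThan_atLeast0)
    then have "(\<Sum>j\<in>S. col_square (equiangular_mat N) j) = (\<Sum>j<N. cis (2 * pi * real j / real N))"
      by (simp add: col_square_equiangular_mat)
    then show ?thesis using sum_cis_roots_unity[of N] N by simp
  qed
  have lower: "\<exists>S \<subseteq> {0..<N}. card S = 3 \<and> 0 \<le> norm (\<Sum>j\<in>S. col_square B j)"
    using N by (intro exI[of _ "{0..<N}"]) simp
  show ?thesis
    by (rule max_cond_number_le[OF equiangular_mat_carrier _ assms(2,3) upper lower])
      (simp_all add: l2_norm_col_equiangular_mat)
next
  assume N: "N = 5"
  \<comment> \<open>Here the threshold is \<open>2 * cos (pi / 5)\<close>, and the five points are
    the squared columns of \<open>B\<close>.\<close>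
  have lower: "\<exists>S \<subseteq> {0..<N}. card S = 3 \<and> 2 * cos (pi / 5) \<le> norm (\<Sum>j\<in>S. col_square B j)"
    unfolding N using assms N by (intro five_units_triple_bound norm_col_square) auto
  show ?thesis
    by (rule max_cond_number_le[OF equiangular_mat_carrier _ assms(2,3) _ lower])
      (use equiangular_resultant_le N in \<open>simp_all add: l2_norm_col_equiangular_mat\<close>)
qed

end
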